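(* Let $n$ be even, let $\Omega$ be a constant non-degenerate two-form (a chosen K\"ahler form) on flat $\mathbb{R}^n$, let $\phi$ be a one-form with $d\phi=\Omega$, and let $w$ be a non-zero constant. The Poisson structure on $T^2(\mathbb{R}^n)$, with coordinates $(x^a,U^a,A^a)$, induced by the second-order Lagrangian $$L=w^2\phi(\dot X)+\tfrac12\Omega(\ddot X,\dot X)$$ is $$\{x^a,A^b\}=-\Omega^{ab},\qquad \{U^a,U^b\}=\Omega^{ab},\qquad \{A^a,A^b\}=w^2\Omega^{ab},$$ with all other brackets vanishing. Moreover the equations $$\dddot X=-w^2\dot X$$ are Hamilton's equations (with $U=\dot X$, $A=\ddot X$) for this Poisson structure with the Hamiltonian $$H=\Omega(A,U).$$
   Context: Indices $a,b,\dots=1,\dots,n$ refer to coordinates on $\mathbb{R}^n$, and $x^a$ are the components of $X$. Here $\Omega(X,Y)=\Omega_{ab}X^aY^b$; $d\phi=\Omega$ means $\partial_a\phi_b-\partial_b\phi_a=\Omega_{ab}$; and $\Omega^{ab}$ is defined by $\Omega_{ab}\Omega^{ac}={\delta_b}^c$. $T^2(\mathbb{R}^n)$ is the second-order tangent bundle (2-jets of curves), identified with $T\mathbb{R}^n\oplus T\mathbb{R}^n$ via position, velocity $U$ and acceleration $A$. The Poisson structure "induced by $L$" is obtained by the Dirac procedure as follows. 1. Write $L$ as the first-order Lagrangian $L=w^2\phi(U)+\frac12\Omega(\dot U,U)-\langle\lambda,U-\dot X\rangle$ with Lagrange multipliers $\lambda\in\mathbb{R}^n$. 2. Let $\mathcal{P}_a,\mathcal{R}_a,\mathcal{S}^a$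 be the momenta conjugate to $x^a,U^a,\lambda_a$, with canonical brackets $\{x^a,\mathcal{P}_b\}={\delta^a}_b$, $\{U^a,\mathcal{R}_b\}={\delta^a}_b$, $\{\lambda_a,\mathcal{S}^b\}={\delta^b}_a$ and all others zero. 3. Impose the $3n$ constraints $\mathcal{P}_a-\lambda_a=0$, $\mathcal{R}_a-\frac12\Omega_{ab}U^b=0$, $\mathcal{S}^a=0$. 4. Take the Dirac bracket on the $3n$-dimensional reduced phase space with coordinates $(x^a,U^a,\mathcal{P}_a)$. The Hamiltonian given by the Legendre transform is, on the constraint surface, $H=(\mathcal{P}_a-w^2\phi_a)U^a$. 5. Change coordinates from $(x,U,\mathcal{P})$ to $(x,U,A)$ by setting $A^a=\{U^a,H\}=(\mathcal{P}_b-w^2\phi_b)\Omega^{ab}$. Hamilton's equations for a function $F$ are $\dot F=\{F,H\}$. *)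

theory Defs
  imports "HOL-Analysis.Analysis"
begin

section \<open>Smooth functions and Poisson structures\<close>

text \<open>On a finite-dimensional space, \<open>C\<^sup>k\<^sup>+\<^sup>1\<close> means differentiable with all directional
  derivatives of class \<open>C\<^sup>k\<close>.\<close>

primrec times_cont_diff :: "nat \<Rightarrow> ('a::real_normed_vector \<Rightarrow> 'b::real_normed_vector) \<Rightarrow> bool" where
  "times_cont_diff 0 f \<longleftrightarrow> continuous_on UNIV f"
| "times_cont_diff (Suc k) f \<longleftrightarrow>
     (\<forall>x. f differentiable (at x)) \<and>
     (\<forall>v. times_cont_diff k (\<lambda>x. frechet_derivative f (at x) v))"

definition smooth :: "('a::real_normed_vector \<Rightarrow> 'b::real_normed_vector) \<Rightarrow> bool" where
  "smooth f \<longleftrightarrow> (\<forall>k. times_cont_diff k f)"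

type_synonym 'a bracket = "('a \<Rightarrow> real) \<Rightarrow> ('a \<Rightarrow> real) \<Rightarrow> 'a \<Rightarrow> real"

definition poisson_structure :: "('a::real_normed_vector) bracket \<Rightarrow> bool" where
  "poisson_structure B \<longleftrightarrow>
     (\<forall>F G. smooth F \<longrightarrow> smooth G \<longrightarrow> smooth (B F G)) \<and>
     (\<forall>F G K. smooth F \<longrightarrow> smooth G \<longrightarrow> smooth K \<longrightarrow>
        (\<forall>c d z. B (\<lambda>y. c * F y + d * G y) K z = c * B F K z + d * B G K z)) \<and>
     (\<forall>F G. smooth F \<longrightarrow> smooth G \<longrightarrow> (\<forall>z. B F G z = - B G F z)) \<and>
     (\<forall>F G K. smooth F \<longrightarrow> smooth G \<longrightarrow> smooth K \<longrightarrow>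
        (\<forall>z. B (\<lambda>y. F y * G y) K z = F z * B G K z + G z * B F K z)) \<and>
     (\<forall>F G K. smooth F \<longrightarrow> smooth G \<longrightarrow> smooth K \<longrightarrow>
        (\<forall>z. B F (B G K) z + B G (B K F) z + B K (B F G) z = 0))"

text \<open>Hamilton's equations \<open>dF/dt = {F, H}\<close> for all observables \<open>F\<close>, along a curve defined
  for times in \<open>I\<close>.\<close>

definition hamilton_equations ::
    "('a::real_normed_vector) bracket \<Rightarrow> ('a \<Rightarrow> real) \<Rightarrow> real set \<Rightarrow> (real \<Rightarrow> 'a) \<Rightarrow> bool" where
  "hamilton_equations B H I \<gamma> \<longleftrightarrow>
     (\<forall>F. smooth F \<longrightarrow>
        (\<forall>t\<in>I. ((\<lambda>s. F (\<gamma> s)) has_real_derivative B F H (\<gamma> t)) (at t)))"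


section \<open>Canonical brackets, Dirac brackets, Legendre transform\<close>

text \<open>Phase space over the configuration space \<open>'q\<close> consists of pairs (position, momentum),
  with covectors identified with vectors through the standard inner product.\<close>

definition canonical_bracket :: "('q::euclidean_space \<times> 'q) bracket" where
  "canonical_bracket F G z =
     (\<Sum>b\<in>Basis. frechet_derivative F (at z) (b, 0) * frechet_derivative G (at z) (0, b)
              - frechet_derivative F (at z) (0, b) * frechet_derivative G (at z) (b, 0))"

definition constraint_matrix ::
    "('k::finite \<Rightarrow> ('q::euclidean_space \<times> 'q) \<Rightarrow> real) \<Rightarrow> ('q \<times> 'q) \<Rightarrow> real^'k^'k" where
  "constraint_matrix con z = (\<chi> i j. canonical_bracket (con i) (con j) z)"

definition second_class :: "('k::finite \<Rightarrow> ('q::euclidean_space \<times> 'q) \<Rightarrow> real) \<Rightarrow> bool" where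
  "second_class con \<longleftrightarrow> (\<forall>z. invertible (constraint_matrix con z))"

definition dirac_bracket ::
    "('k::finite \<Rightarrow> ('q::euclidean_space \<times> 'q) \<Rightarrow> real) \<Rightarrow> ('q \<times> 'q) bracket" where
  "dirac_bracket con F G z = canonical_bracket F G z
     - (\<Sum>i\<in>UNIV. \<Sum>j\<in>UNIV. canonical_bracket F (con i) z
          * matrix_inv (constraint_matrix con z) $ i $ j
          * canonical_bracket (con j) G z)"

definition legendre_momentum :: "('q::euclidean_space \<Rightarrow> 'q \<Rightarrow> real) \<Rightarrow> 'q \<Rightarrow> 'q \<Rightarrow> 'q" where
  "legendre_momentum \<L> q v = (\<Sum>b\<in>Basis. frechet_derivative (\<L> q) (at v) b *\<^sub>R b)"

definition legendre_energy :: "('q::euclidean_space \<Rightarrow> 'q \<Rightarrow> real) \<Rightarrow> 'q \<Rightarrow> 'q \<Rightarrow> real" where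
  "legendre_energy \<L> q v = legendre_momentum \<L> q v \<bullet> v - \<L> q v"


section \<open>Forms on \<open>\<real>\<^sup>n\<close>\<close>

text \<open>A constant two-form is given by its components \<open>\<Omega>\<^sub>a\<^sub>b = \<Omega> $ a $ b\<close>, a one-form \<open>\<phi>\<close>
  by its component functions \<open>\<phi>\<^sub>a(x) = \<phi> x $ a\<close>.\<close>

definition two_form :: "real^'n^'n \<Rightarrow> bool" where
  "two_form \<Omega> \<longleftrightarrow> (\<forall>a b. \<Omega> $ a $ b = - \<Omega> $ b $ a)"

definition form2 :: "real^'n^'n \<Rightarrow> real^'n \<Rightarrow> real^'n \<Rightarrow> real" where
  "form2 \<Omega> X Y = (\<Sum>a\<in>UNIV. \<Sum>b\<in>UNIV. \<Omega> $ a $ b * X $ a * Y $ b)"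

definition nondegenerate :: "real^'n^'n \<Rightarrow> bool" where
  "nondegenerate \<Omega> \<longleftrightarrow> (\<forall>X. (\<forall>Y. form2 \<Omega> X Y = 0) \<longrightarrow> X = 0)"

text \<open>The inverse components, \<open>\<Omega>\<^sub>a\<^sub>b \<Omega>\<^sup>a\<^sup>c = \<delta>\<^sub>b\<^sup>c\<close>. The contraction is over the first indices,
  so for a two-form this is minus the inverse matrix.\<close>

definition raised :: "real^'n^'n \<Rightarrow> real^'n^'n" where
  "raised \<Omega> = (THE W. \<forall>b c. (\<Sum>a\<in>UNIV. \<Omega> $ a $ b * W $ a $ c) = (if b = c then 1 else 0))"

lemma raised_eq:
  fixes \<Omega> :: "real^'n^'n"
  assumes "nondegenerate \<Omega>"
  shows "(\<Sum>a\<in>UNIV. \<Omega> $ a $ b * raised \<Omega> $ a $ c) = (if b = c then 1 else 0)"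
proof -
  let ?P = "\<lambda>W. \<forall>b c. (\<Sum>a\<in>UNIV. \<Omega> $ a $ b * W $ a $ c) = (if b = c then 1 else 0)"
  have P_iff: "?P W \<longleftrightarrow> transpose \<Omega> ** W = mat 1" for W
    by (simp add: matrix_matrix_mult_def transpose_def mat_def vec_eq_iff)
  have form: "form2 \<Omega> X Y = (transpose \<Omega> *v X) \<bullet> Y" for X Y
    unfolding form2_def inner_vec_def matrix_vector_mult_def transpose_def
    by (subst sum.swap) (simp add: sum_distrib_left mult_ac)
  have "X = 0" if "transpose \<Omega> *v X = 0" for X
    using assms that unfolding nondegenerate_def by (simp add: form)
  then obtain B where "B ** transpose \<Omega> = mat 1"
    using matrix_left_invertible_ker[of "transpose \<Omega>"] by blast
  then have B: "transpose \<Omega> ** B = mat 1"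
    by (simp add: matrix_left_right_inverse)
  have "\<exists>!W. ?P W"
  proof (rule ex1I[of _ B])
    show "?P B" using B P_iff by blast
    fix W assume "?P W"
    then have "transpose \<Omega> ** W = mat 1" using P_iff by blast
    then show "W = B"
      by (metis B matrix_left_right_inverse matrix_mul_assoc matrix_mul_lid matrix_mul_rid)
  qed
  from theI'[OF this] show ?thesis unfolding raised_def by blast
qed

definition partial_deriv :: "'n::finite \<Rightarrow> (real^'n \<Rightarrow> real) \<Rightarrow> real^'n \<Rightarrow> real" where
  "partial_deriv a f x = frechet_derivative f (at x) (axis a 1)"

definition exterior_deriv :: "(real^'n \<Rightarrow> real^'n) \<Rightarrow> real^'n \<Rightarrow> real^'n^'n" where
  "exterior_deriv \<phi> x =
     (\<chi> a b. partial_deriv a (\<lambda>y. \<phi> y $ b) x - partial_deriv b (\<lambda>y. \<phi> y $ a) x)"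


section \<open>The Lagrangian and the induced bracket\<close>

text \<open>\<open>T\<^sup>2(\<real>\<^sup>n)\<close> in the coordinates \<open>(x, U, A)\<close>: position, velocity, acceleration.\<close>

type_synonym 'n jet2 = "(real^'n) \<times> (real^'n) \<times> (real^'n)"

definition lagrangian2 :: "real \<Rightarrow> (real^'n \<Rightarrow> real^'n) \<Rightarrow> real^'n^'n \<Rightarrow> 'n jet2 \<Rightarrow> real" where
  "lagrangian2 w \<phi> \<Omega> = (\<lambda>(x, U, A). w\<^sup>2 * (\<phi> x \<bullet> U) + 1/2 * form2 \<Omega> A U)"

text \<open>Configurations are \<open>(x, U, \<lambda>)\<close>, with \<open>\<lambda>\<close> the multiplier imposing \<open>U = dx/dt\<close>; their
  velocities are \<open>(x', U', \<lambda>')\<close> and their conjugate momenta \<open>(P, R, S)\<close>.\<close>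

type_synonym 'n config = "(real^'n) \<times> (real^'n) \<times> (real^'n)"

definition lagrangian1 ::
    "real \<Rightarrow> (real^'n \<Rightarrow> real^'n) \<Rightarrow> real^'n^'n \<Rightarrow> 'n config \<Rightarrow> 'n config \<Rightarrow> real" where
  "lagrangian1 w \<phi> \<Omega> = (\<lambda>(x, U, l) (x', U', l'). lagrangian2 w \<phi> \<Omega> (x, U, U') - l \<bullet> (U - x'))"

definition constraint ::
    "real^'n^'n \<Rightarrow> 'n + 'n + 'n \<Rightarrow> 'n config \<times> 'n config \<Rightarrow> real" where
  "constraint \<Omega> i = (\<lambda>((x, U, l), (P, R, S)).
     (case i of
        Inl a \<Rightarrow> P $ a - l $ a
      | Inr (Inl a) \<Rightarrow> R $ a - 1/2 * (\<Sum>b\<in>UNIV. \<Omega> $ a $ b * U $ b)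
      | Inr (Inr a) \<Rightarrow> S $ a))"

definition constraint_surface :: "real^'n^'n \<Rightarrow> ('n config \<times> 'n config) set" where
  "constraint_surface \<Omega> = {z. \<forall>i. constraint \<Omega> i z = 0}"

text \<open>The reduced phase space is the constraint surface, with coordinates \<open>(x, U, P)\<close>.\<close>

type_synonym 'n reduced = "(real^'n) \<times> (real^'n) \<times> (real^'n)"

definition reduced_coords :: "'n config \<times> 'n config \<Rightarrow> 'n::finite reduced" where
  "reduced_coords = (\<lambda>((x, U, l), (P, R, S)). (x, U, P))"

definition surface_point :: "real^'n^'n \<Rightarrow> 'n reduced \<Rightarrow> 'n config \<times> 'n config" where
  "surface_point \<Omega> = (\<lambda>(x, U, P). ((x, U, P), (P, (1/2) *\<^sub>R (\<Omega> *v U), 0)))"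

text \<open>Functions of \<open>(x, U, P)\<close> are extended off the constraint surface by making them independent
  of \<open>\<lambda>, R, S\<close>. The choice does not matter, as the Dirac bracket with a constraint vanishes.\<close>

definition reduced_bracket :: "real^'n^'n \<Rightarrow> 'n reduced bracket" where
  "reduced_bracket \<Omega> f g z =
     dirac_bracket (constraint \<Omega>) (f \<circ> reduced_coords) (g \<circ> reduced_coords) (surface_point \<Omega> z)"

definition reduced_hamiltonian :: "real \<Rightarrow> (real^'n \<Rightarrow> real^'n) \<Rightarrow> 'n reduced \<Rightarrow> real" where
  "reduced_hamiltonian w \<phi> = (\<lambda>(x, U, P). \<Sum>a\<in>UNIV. (P $ a - w\<^sup>2 * \<phi> x $ a) * U $ a)"

text \<open>The change of coordinates \<open>(x, U, P) \<mapsto> (x, U, A)\<close> with \<open>A\<^sup>a = {U\<^sup>a, H}\<close>.\<close>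

definition to_jet2 :: "real \<Rightarrow> (real^'n \<Rightarrow> real^'n) \<Rightarrow> real^'n^'n \<Rightarrow> 'n reduced \<Rightarrow> 'n jet2" where
  "to_jet2 w \<phi> \<Omega> = (\<lambda>(x, U, P).
     (x, U, \<chi> a. reduced_bracket \<Omega> (\<lambda>(y, V, Q). V $ a) (reduced_hamiltonian w \<phi>) (x, U, P)))"

definition induced_bracket :: "real \<Rightarrow> (real^'n \<Rightarrow> real^'n) \<Rightarrow> real^'n^'n \<Rightarrow> 'n jet2 bracket" where
  "induced_bracket w \<phi> \<Omega> F G y =
     reduced_bracket \<Omega> (F \<circ> to_jet2 w \<phi> \<Omega>) (G \<circ> to_jet2 w \<phi> \<Omega>) (inv (to_jet2 w \<phi> \<Omega>) y)"

definition x_coord :: "'n \<Rightarrow> 'n::finite jet2 \<Rightarrow> real" where "x_coord a = (\<lambda>(x, U, A). x $ a)"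
definition U_coord :: "'n \<Rightarrow> 'n::finite jet2 \<Rightarrow> real" where "U_coord a = (\<lambda>(x, U, A). U $ a)"
definition A_coord :: "'n \<Rightarrow> 'n::finite jet2 \<Rightarrow> real" where "A_coord a = (\<lambda>(x, U, A). A $ a)"

definition jet2_hamiltonian :: "real^'n^'n \<Rightarrow> 'n jet2 \<Rightarrow> real" where
  "jet2_hamiltonian \<Omega> = (\<lambda>(x, U, A). form2 \<Omega> A U)"

end

theory Submission
  imports Defs
begin

text \<open>
  The first-order Lagrangian is affine in the velocities, so its Legendre transform maps onto the surface
  cut out by the linear constraints \<open>P = \<lambda>\<close>, \<open>R = \<Omega> U / 2\<close>, \<open>S = 0\<close>. Their matrix of
  canonical brackets is constant and falls into two invertible blocks, one pairing the first with the
  third family and one equal to \<open>-\<Omega>\<close>. Inverting it gives the Dirac bracket on the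
  reduced phase space: \<open>x\<close> and \<open>P\<close> remain canonically conjugate and
  \<open>{U\<^sup>a, U\<^sup>b} = \<Omega>\<^sup>a\<^sup>b\<close> (lemma \<open>reduced_bracket_GDERIV\<close>).

  With \<open>W\<close> for the matrix \<open>\<Omega>\<^sup>a\<^sup>b\<close>, the new coordinate is \<open>A = W (P - w\<^sup>2 \<phi>(x))\<close>. In the
  coordinates \<open>(x, U, A)\<close> the potential \<open>\<phi>\<close> enters the bracket only through its
  antisymmetrised Jacobian \<open>d\<phi> = \<Omega>\<close>, so all coefficients become constant; this is where
  \<open>{A\<^sup>a, A\<^sup>b} = w\<^sup>2 \<Omega>\<^sup>a\<^sup>b\<close> comes from (lemma \<open>induced_bracket_GDERIV\<close>). It follows that
  the induced bracket is a Poisson structure, because every constant skew bivector defines one: the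
  cyclic sum in the Jacobi identity cancels by the symmetry of second derivatives (lemmas
  \<open>jacobi_bivector_bracket\<close> and \<open>directional_derivatives_commute\<close>).

  For Hamilton's equations, the Hamiltonian \<open>(P - w\<^sup>2 \<phi>) U\<close> becomes \<open>\<Omega>(A, U)\<close>, whose Hamiltonian vector
  field is \<open>(U, A, -w\<^sup>2 U)\<close> because \<open>W\<close> is minus the inverse of \<open>\<Omega>\<close>
  (lemma \<open>hamiltonian_vector_field\<close>). A curve satisfies Hamilton's equations for all smooth observables
  exactly when it is an integral curve of that field.
\<close>

section \<open>Smooth functions and symmetry of second derivatives\<close>

lemma times_cont_diff_continuous: "times_cont_diff k f \<Longrightarrow> continuous_on UNIV f"
  by (cases k) (auto intro!: continuous_at_imp_continuous_on differentiable_imp_continuous_within)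

text \<open>The recursive definition of \<open>C\<^sup>k\<close> does not contain \<open>C\<^sup>k\<^sup>+\<^sup>1 \<subseteq> C\<^sup>k\<close> as a clause. The product rule needs it:
  it multiplies a derivative, which has lost one order, by an undifferentiated factor.\<close>

lemma times_cont_diff_SucD: "times_cont_diff (Suc k) f \<Longrightarrow> times_cont_diff k f"
proof (induction k arbitrary: f)
  case 0
  then show ?case using times_cont_diff_continuous[OF 0] by simp
next
  case (Suc k)
  from Suc.prems have "\<forall>x. f differentiable (at x)"
    and "\<forall>v. times_cont_diff (Suc k) (\<lambda>x. frechet_derivative f (at x) v)"
    unfolding times_cont_diff.simps(2)[of "Suc k"] by blast+
  then show ?case using Suc.IH by simp
qed

lemma smooth_differentiable: "smooth f \<Longrightarrow> f differentiable (at x)"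
  unfolding smooth_def by (drule spec[of _ 1]) simp

lemma smooth_frechet_derivative: "smooth f \<Longrightarrow> smooth (\<lambda>x. frechet_derivative f (at x) v)"
  unfolding smooth_def
proof
  fix k
  assume "\<forall>k. times_cont_diff k f"
  then have "times_cont_diff (Suc k) f" ..
  then show "times_cont_diff k (\<lambda>x. frechet_derivative f (at x) v)" by simp
qed

lemma times_cont_diff_const: "times_cont_diff k (\<lambda>x. c)"
  by (induction k arbitrary: c) (simp_all add: frechet_derivative_const)

lemma smooth_const: "smooth (\<lambda>x. c)"
  by (simp add: smooth_def times_cont_diff_const)

lemma smooth_bounded_linear:
  assumes "bounded_linear f"
  shows "smooth f"
  unfolding smooth_def
proof
  fix k
  have D: "frechet_derivative f (at x) = f" for x
    using assms by (metis bounded_linear_imp_has_derivative frechet_derivative_at)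
  show "times_cont_diff k f"
    using assms bounded_linear_imp_differentiable[OF assms]
    by (cases k) (auto simp: D times_cont_diff_const linear_continuous_on)
qed

lemma frechet_derivative_eqI: "(f has_derivative f') (at x) \<Longrightarrow> frechet_derivative f (at x) v = f' v"
  using frechet_derivative_at by metis

lemma frechet_derivative_add:
  assumes "f differentiable (at x)" "g differentiable (at x)"
  shows "frechet_derivative (\<lambda>x. f x + g x) (at x) v
    = frechet_derivative f (at x) v + frechet_derivative g (at x) v"
  by (rule frechet_derivative_eqI)
    (intro has_derivative_add iffD1[OF frechet_derivative_works] assms)

lemma frechet_derivative_mult:
  fixes f g :: "'a::real_normed_vector \<Rightarrow> real"
  assumes "f differentiable (at x)" "g differentiable (at x)"
  shows "frechet_derivative (\<lambda>x. f x * g x) (at x) v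
    = f x * frechet_derivative g (at x) v + frechet_derivative f (at x) v * g x"
  by (rule frechet_derivative_eqI)
    (intro has_derivative_mult iffD1[OF frechet_derivative_works] assms)

lemma times_cont_diff_add:
  "times_cont_diff k f \<Longrightarrow> times_cont_diff k g \<Longrightarrow> times_cont_diff k (\<lambda>x. f x + g x)"
proof (induction k arbitrary: f g)
  case 0
  then show ?case by (simp add: continuous_on_add)
next
  case (Suc k)
  then show ?case by (simp add: frechet_derivative_add)
qed

lemma times_cont_diff_mult:
  fixes f g :: "'a::real_normed_vector \<Rightarrow> real"
  shows "times_cont_diff k f \<Longrightarrow> times_cont_diff k g \<Longrightarrow> times_cont_diff k (\<lambda>x. f x * g x)"
proof (induction k arbitrary: f g)
  case 0
  then show ?case by (simp add: continuous_on_mult)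
next
  case (Suc k)
  have "times_cont_diff k f" "times_cont_diff k g"
    using Suc.prems by (simp_all add: times_cont_diff_SucD del: times_cont_diff.simps)
  then have "times_cont_diff k (\<lambda>x. f x * frechet_derivative g (at x) v + frechet_derivative f (at x) v * g x)" for v
    using Suc.prems by (intro times_cont_diff_add Suc.IH) simp_all
  then show ?case
    using Suc.prems by (simp add: frechet_derivative_mult)
qed

lemma smooth_add: "smooth f \<Longrightarrow> smooth g \<Longrightarrow> smooth (\<lambda>x. f x + g x)"
  by (simp add: smooth_def times_cont_diff_add)

lemma smooth_mult:
  fixes f g :: "'a::real_normed_vector \<Rightarrow> real"
  shows "smooth f \<Longrightarrow> smooth g \<Longrightarrow> smooth (\<lambda>x. f x * g x)"
  by (simp add: smooth_def times_cont_diff_mult)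

lemma smooth_sum:
  assumes "\<And>i. i \<in> I \<Longrightarrow> smooth (f i)"
  shows "smooth (\<lambda>x. \<Sum>i\<in>I. f i x)"
  using assms by (induction I rule: infinite_finite_induct) (simp_all add: smooth_const smooth_add)

lemma has_real_derivative_along_line:
  fixes f :: "'a::real_normed_vector \<Rightarrow> real"
  assumes "f differentiable (at (p + t *\<^sub>R v))"
  shows "((\<lambda>s. f (p + s *\<^sub>R v)) has_real_derivative
    frechet_derivative f (at (p + t *\<^sub>R v)) v) (at t)"
proof -
  let ?f' = "frechet_derivative f (at (p + t *\<^sub>R v))"
  have f': "(f has_derivative ?f') (at (p + t *\<^sub>R v))"
    using assms by (rule iffD1[OF frechet_derivative_works])
  have "((\<lambda>s. f (p + s *\<^sub>R v)) has_derivative (\<lambda>s. ?f' (s *\<^sub>R v))) (at t)"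
    by (rule has_derivative_compose[where f = "\<lambda>s. p + s *\<^sub>R v", OF _ f'])
      (auto intro!: derivative_eq_intros)
  moreover have "?f' (s *\<^sub>R v) = ?f' v * s" for s
    using linear_scale[OF has_derivative_linear[OF f']] by simp
  ultimately show ?thesis by (simp add: has_field_derivative_def)
qed

text \<open>The mean value theorem, applied along \<open>u\<close> to \<open>s \<mapsto> f (z + h v + s u) - f (z + s u)\<close> and then
  along \<open>v\<close> to the \<open>u\<close>-derivative of \<open>f\<close>. The left-hand side is symmetric in \<open>u\<close> and \<open>v\<close>,
  which is what makes the mixed derivatives agree.\<close>

lemma second_difference_mean_value:
  fixes f :: "'a::real_normed_vector \<Rightarrow> real"
  assumes f: "smooth f" and h: "h > 0"
  obtains s t where "0 < s" "s < h" "0 < t" "t < h"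
    "f (z + h *\<^sub>R u + h *\<^sub>R v) - f (z + h *\<^sub>R u) - f (z + h *\<^sub>R v) + f z
      = h * (h * frechet_derivative (\<lambda>x. frechet_derivative f (at x) u) (at (z + s *\<^sub>R u + t *\<^sub>R v)) v)"
proof -
  let ?g = "\<lambda>x. frechet_derivative f (at x) u"
  let ?D = "\<lambda>s. f (z + h *\<^sub>R v + s *\<^sub>R u) - f (z + s *\<^sub>R u)"
  have "\<exists>s>0. s < h \<and> ?D h - ?D 0 = (h - 0) * (?g (z + h *\<^sub>R v + s *\<^sub>R u) - ?g (z + s *\<^sub>R u))"
    by (rule MVT2[OF h])
      (intro DERIV_diff has_real_derivative_along_line smooth_differentiable f)
  then obtain s where s: "0 < s" "s < h"
    and D: "?D h - ?D 0 = h * (?g (z + h *\<^sub>R v + s *\<^sub>R u) - ?g (z + s *\<^sub>R u))" by auto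
  have "\<exists>t>0. t < h \<and> ?g (z + s *\<^sub>R u + h *\<^sub>R v) - ?g (z + s *\<^sub>R u + 0 *\<^sub>R v)
      = (h - 0) * frechet_derivative ?g (at (z + s *\<^sub>R u + t *\<^sub>R v)) v"
    by (rule MVT2[OF h])
      (intro has_real_derivative_along_line smooth_differentiable smooth_frechet_derivative f)
  then obtain t where t: "0 < t" "t < h"
    and g: "?g (z + s *\<^sub>R u + h *\<^sub>R v) - ?g (z + s *\<^sub>R u)
      = h * frechet_derivative ?g (at (z + s *\<^sub>R u + t *\<^sub>R v)) v" by auto
  show ?thesis
    by (rule that[OF s t]) (use D g in \<open>simp add: algebra_simps\<close>)
qed

text \<open>The symmetric second difference is \<open>h\<^sup>2\<close> times either mixed derivative, each taken at some
  point within distance of order \<open>h\<close> from \<open>z\<close>; continuity of both as \<open>h \<rightarrow> 0\<close> identifies them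
  at \<open>z\<close>.\<close>

lemma directional_derivatives_commute:
  fixes f :: "'a::real_normed_vector \<Rightarrow> real"
  assumes f: "smooth f"
  shows "frechet_derivative (\<lambda>x. frechet_derivative f (at x) u) (at z) v
    = frechet_derivative (\<lambda>x. frechet_derivative f (at x) v) (at z) u"
proof -
  define a where "a = (\<lambda>x. frechet_derivative (\<lambda>x. frechet_derivative f (at x) u) (at x) v)"
  define b where "b = (\<lambda>x. frechet_derivative (\<lambda>x. frechet_derivative f (at x) v) (at x) u)"
  have cont: "isCont a z" "isCont b z"
    unfolding a_def b_def
    by (intro differentiable_imp_continuous_within smooth_differentiable smooth_frechet_derivative f)+
  have "\<bar>a z - b z\<bar> \<le> 0 + e" if "e > 0" for e
  proof -
    have e2: "e / 2 > 0" using that by simp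
    obtain d1 where d1: "d1 > 0" "\<And>x. dist x z < d1 \<Longrightarrow> dist (a x) (a z) < e / 2"
      using cont(1) e2 unfolding continuous_at_eps_delta by metis
    obtain d2 where d2: "d2 > 0" "\<And>x. dist x z < d2 \<Longrightarrow> dist (b x) (b z) < e / 2"
      using cont(2) e2 unfolding continuous_at_eps_delta by metis
    \<comment> \<open>The summand 1 keeps the denominator positive when both directions vanish.\<close>
    define h where "h = min d1 d2 / (norm u + norm v + 1)"
    have n: "norm u + norm v + 1 > 0"
      by (smt (verit) norm_ge_zero)
    have h: "h > 0" using d1 d2 n by (simp add: h_def)
    have near: "dist (z + s *\<^sub>R u + t *\<^sub>R v) z < min d1 d2" if "0 < s" "s < h" "0 < t" "t < h" for s t
    proof -
      have "dist (z + s *\<^sub>R u + t *\<^sub>R v) z = norm (s *\<^sub>R u + t *\<^sub>R v)"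
        by (simp add: dist_norm algebra_simps)
      also have "\<dots> \<le> s * norm u + t * norm v"
        using that norm_triangle_ineq[of "s *\<^sub>R u" "t *\<^sub>R v"] by simp
      also have "\<dots> \<le> h * norm u + h * norm v"
        using that by (intro add_mono mult_right_mono) auto
      also have "\<dots> < h * (norm u + norm v + 1)"
        using h by (simp add: algebra_simps)
      also have "\<dots> = min d1 d2" using n by (simp add: h_def)
      finally show ?thesis .
    qed
    obtain s t where st: "0 < s" "s < h" "0 < t" "t < h"
      "f (z + h *\<^sub>R u + h *\<^sub>R v) - f (z + h *\<^sub>R u) - f (z + h *\<^sub>R v) + f z
        = h * (h * a (z + s *\<^sub>R u + t *\<^sub>R v))"
      using second_difference_mean_value[OF f h, of z u v] unfolding a_def by metis
    obtain s' t' where st': "0 < s'" "s' < h" "0 < t'" "t' < h"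
      "f (z + h *\<^sub>R v + h *\<^sub>R u) - f (z + h *\<^sub>R v) - f (z + h *\<^sub>R u) + f z
        = h * (h * b (z + s' *\<^sub>R v + t' *\<^sub>R u))"
      using second_difference_mean_value[OF f h, of z v u] unfolding b_def by metis
    have swap: "z + r *\<^sub>R v + r' *\<^sub>R u = z + r' *\<^sub>R u + r *\<^sub>R v" for r r' by simp
    have "h * (h * a (z + s *\<^sub>R u + t *\<^sub>R v)) = h * (h * b (z + t' *\<^sub>R u + s' *\<^sub>R v))"
      using st(5) st'(5) unfolding swap by linarith
    then have "a (z + s *\<^sub>R u + t *\<^sub>R v) = b (z + t' *\<^sub>R u + s' *\<^sub>R v)"
      using h by simp
    then show ?thesis
      using d1(2)[OF order.strict_trans2[OF near[OF st(1-4)] min.cobounded1]]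
        d2(2)[OF order.strict_trans2[OF near[OF st'(3,4,1,2)] min.cobounded2]]
      unfolding dist_real_def by linarith
  qed
  then have "\<bar>a z - b z\<bar> \<le> 0" by (rule field_le_epsilon)
  then show ?thesis by (simp add: a_def b_def)
qed

section \<open>Gradients\<close>

text \<open>Brackets are evaluated on gradients, which replaces sums over bases by inner products of vectors.\<close>

lemma GDERIV_frechet_derivative: "GDERIV F z :> df \<Longrightarrow> frechet_derivative F (at z) h = h \<bullet> df"
  unfolding gderiv_def by (rule frechet_derivative_eqI)

lemma differentiable_GDERIV:
  fixes F :: "'a::euclidean_space \<Rightarrow> real"
  assumes "F differentiable (at z)"
  obtains df where "GDERIV F z :> df"
proof -
  obtain F' where F': "(F has_derivative F') (at z)"
    using assms unfolding differentiable_def ..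
  have "F' h = h \<bullet> (\<Sum>b\<in>Basis. F' b *\<^sub>R b)" for h
    using linear_sum[OF has_derivative_linear[OF F'], of "\<lambda>b. (h \<bullet> b) *\<^sub>R b" Basis]
    by (simp add: euclidean_representation linear_scale[OF has_derivative_linear[OF F']]
        inner_sum_right mult_ac)
  then have "F' = (\<lambda>h. h \<bullet> (\<Sum>b\<in>Basis. F' b *\<^sub>R b))" ..
  then show thesis
    using F' that unfolding gderiv_def by metis
qed

lemma GDERIV_inner_left: "GDERIV (\<lambda>z. z \<bullet> c) z :> c"
  unfolding gderiv_def by (intro bounded_linear_imp_has_derivative bounded_linear_inner_left)

section \<open>Constant Poisson structures\<close>

text \<open>A constant bivector is encoded by the map \<open>J\<close> from covectors to vectors, covectors being
  identified with vectors through the inner product; only the matrix \<open>i \<bullet> J j\<close> enters.\<close>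

definition bivector_bracket :: "('a::euclidean_space \<Rightarrow> 'a) \<Rightarrow> 'a bracket" where
  "bivector_bracket J F G z = (\<Sum>i\<in>Basis. \<Sum>j\<in>Basis.
     (i \<bullet> J j) * (frechet_derivative F (at z) i * frechet_derivative G (at z) j))"

lemma smooth_bivector_bracket:
  assumes "smooth F" "smooth G"
  shows "smooth (bivector_bracket J F G)"
proof -
  have "smooth (\<lambda>z. bivector_bracket J F G z)"
    unfolding bivector_bracket_def
    by (intro smooth_sum smooth_mult smooth_const smooth_frechet_derivative assms)
  then show ?thesis by simp
qed

lemma has_derivative_bivector_bracket:
  assumes "smooth F" "smooth G"
  shows "(bivector_bracket J F G has_derivative (\<lambda>v.
    \<Sum>i\<in>Basis. \<Sum>j\<in>Basis. (i \<bullet> J j) *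
      (frechet_derivative F (at z) i
          * frechet_derivative (\<lambda>x. frechet_derivative G (at x) j) (at z) v
        + frechet_derivative (\<lambda>x. frechet_derivative F (at x) i) (at z) v
          * frechet_derivative G (at z) j))) (at z)"
  unfolding bivector_bracket_def[abs_def]
  by (intro has_derivative_sum has_derivative_mult_right has_derivative_mult
      iffD1[OF frechet_derivative_works] smooth_differentiable smooth_frechet_derivative assms)

lemma sum_reverse4:
  "(\<Sum>i\<in>A. \<Sum>j\<in>B. \<Sum>k\<in>C. \<Sum>l\<in>D. f i j k l) = (\<Sum>l\<in>D. \<Sum>k\<in>C. \<Sum>j\<in>B. \<Sum>i\<in>A. f i j k l)"
  (is "?L = _")
proof -
  have "?L = (\<Sum>i\<in>A. \<Sum>k\<in>C. \<Sum>j\<in>B. \<Sum>l\<in>D. f i j k l)"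
    by (intro sum.cong refl) (rule sum.swap)
  also have "\<dots> = (\<Sum>k\<in>C. \<Sum>i\<in>A. \<Sum>l\<in>D. \<Sum>j\<in>B. f i j k l)"
    by (subst sum.swap) (intro sum.cong refl, rule sum.swap)
  also have "\<dots> = (\<Sum>k\<in>C. \<Sum>l\<in>D. \<Sum>i\<in>A. \<Sum>j\<in>B. f i j k l)"
    by (intro sum.cong refl) (rule sum.swap)
  also have "\<dots> = (\<Sum>l\<in>D. \<Sum>k\<in>C. \<Sum>j\<in>B. \<Sum>i\<in>A. f i j k l)"
    by (subst sum.swap) (intro sum.cong refl, rule sum.swap)
  finally show ?thesis .
qed

text \<open>As the coefficients are constant, the nested bracket \<open>{F, {G, K}}\<close> contains second derivatives
  only of \<open>G\<close> and \<open>K\<close>. With \<open>T F G K\<close> for the part where \<open>G\<close> is differentiated twice,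
  skewness of \<open>J\<close> gives \<open>{F, {G, K}} = T F G K - T F K G\<close>. Symmetry of the second
  derivatives gives \<open>T F G K = T K G F\<close>, and the six terms of the cyclic sum cancel in pairs.\<close>

lemma jacobi_bivector_bracket:
  assumes skew: "\<And>u v. u \<bullet> J v = - (v \<bullet> J u)"
    and "smooth F" "smooth G" "smooth K"
  shows "bivector_bracket J F (bivector_bracket J G K) z + bivector_bracket J G (bivector_bracket J K F) z
    + bivector_bracket J K (bivector_bracket J F G) z = 0"
proof -
  define D where "D = (\<lambda>F::'a\<Rightarrow>real. frechet_derivative F (at z))"
  define H where "H = (\<lambda>(F::'a\<Rightarrow>real) i j. frechet_derivative (\<lambda>x. frechet_derivative F (at x) i) (at z) j)"
  define T where "T = (\<lambda>F G K. \<Sum>i\<in>Basis. \<Sum>j\<in>Basis. \<Sum>k\<in>Basis. \<Sum>l\<in>Basis.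
    (i \<bullet> J j) * (k \<bullet> J l) * (D F i * H G k j * D K l))"
  have expand: "bivector_bracket J F (bivector_bracket J G K) z = T F G K - T F K G"
    if "smooth F" "smooth G" "smooth K" for F G K
  proof -
    have "bivector_bracket J F (bivector_bracket J G K) z
      = (\<Sum>i\<in>Basis. \<Sum>j\<in>Basis. (i \<bullet> J j) * (D F i *
          (\<Sum>k\<in>Basis. \<Sum>l\<in>Basis. (k \<bullet> J l) * (D G k * H K l j + H G k j * D K l))))"
      unfolding bivector_bracket_def[of J F] D_def H_def
        frechet_derivative_eqI[OF has_derivative_bivector_bracket[OF that(2,3)]] ..
    also have "\<dots> = T F G K + (\<Sum>i\<in>Basis. \<Sum>j\<in>Basis. \<Sum>k\<in>Basis. \<Sum>l\<in>Basis.
        (i \<bullet> J j) * (k \<bullet> J l) * (D F i * H K l j * D G k))"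
      unfolding T_def by (simp add: sum_distrib_left sum.distrib[symmetric] algebra_simps)
    also have "(\<Sum>i\<in>Basis. \<Sum>j\<in>Basis. \<Sum>k\<in>Basis. \<Sum>l\<in>Basis.
        (i \<bullet> J j) * (k \<bullet> J l) * (D F i * H K l j * D G k)) = - T F K G"
    proof -
      have "(\<Sum>k\<in>Basis. \<Sum>l\<in>Basis. (i \<bullet> J j) * (k \<bullet> J l) * (D F i * H K l j * D G k))
        = - (\<Sum>k\<in>Basis. \<Sum>l\<in>Basis. (i \<bullet> J j) * (k \<bullet> J l) * (D F i * H K k j * D G l))" for i j
        by (subst sum.swap) (subst skew, simp add: sum_negf)
      then show ?thesis by (simp add: T_def sum_negf)
    qed
    finally show ?thesis by simp
  qed
  have sym: "T F G K = T K G F" if "smooth F" "smooth G" "smooth K" for F G K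
  proof -
    have G: "H G i j = H G j i" for i j
      unfolding H_def by (rule directional_derivatives_commute) fact
    \<comment> \<open>Reversing the order of the four indices flips both coefficients, so the signs cancel.\<close>
    have "T F G K = (\<Sum>l\<in>Basis. \<Sum>k\<in>Basis. \<Sum>j\<in>Basis. \<Sum>i\<in>Basis.
        (i \<bullet> J j) * (k \<bullet> J l) * (D F i * H G k j * D K l))"
      unfolding T_def
      using sum_reverse4 .
    also have "\<dots> = T K G F"
      unfolding T_def
      by (intro sum.cong refl) (subst (1 2) skew, subst G, simp add: mult_ac)
    finally show ?thesis .
  qed
  show ?thesis
    using assms(2-4) by (simp add: expand sym[of F G K] sym[of G K F] sym[of K F G])
qed

lemma bivector_bracket_poisson_structure:
  assumes skew: "\<And>u v. u \<bullet> J v = - (v \<bullet> J u)"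
  shows "poisson_structure (bivector_bracket J)"
  unfolding poisson_structure_def
proof (intro conjI allI impI)
  fix F G K :: "'a \<Rightarrow> real" and c d z
  show "smooth F \<Longrightarrow> smooth G \<Longrightarrow> smooth (bivector_bracket J F G)"
    by (rule smooth_bivector_bracket)
  show "bivector_bracket J F G z = - bivector_bracket J G F z"
    unfolding bivector_bracket_def
    by (subst sum.swap) (subst skew, simp add: sum_negf mult_ac)
  assume F: "smooth F" and G: "smooth G"
  note d = smooth_differentiable[OF F] smooth_differentiable[OF G]
  have "frechet_derivative (\<lambda>y. c * F y + d * G y) (at z) i
    = c * frechet_derivative F (at z) i + d * frechet_derivative G (at z) i" for i
    using d by (simp add: frechet_derivative_add frechet_derivative_mult frechet_derivative_const)
  then show "bivector_bracket J (\<lambda>y. c * F y + d * G y) K z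
      = c * bivector_bracket J F K z + d * bivector_bracket J G K z"
    by (simp add: bivector_bracket_def sum_distrib_left sum.distrib[symmetric] algebra_simps)
  have "frechet_derivative (\<lambda>y. F y * G y) (at z) i
    = F z * frechet_derivative G (at z) i + G z * frechet_derivative F (at z) i" for i
    using d by (simp add: frechet_derivative_mult)
  then show "bivector_bracket J (\<lambda>y. F y * G y) K z
      = F z * bivector_bracket J G K z + G z * bivector_bracket J F K z"
    by (simp add: bivector_bracket_def sum_distrib_left sum.distrib[symmetric] algebra_simps)
  show "smooth K \<Longrightarrow> bivector_bracket J F (bivector_bracket J G K) z + bivector_bracket J G (bivector_bracket J K F) z
    + bivector_bracket J K (bivector_bracket J F G) z = 0"
    by (rule jacobi_bivector_bracket[OF skew F G])
qed

text \<open>Agreement on smooth arguments suffices because the axioms only nest brackets of smooth functions,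
  and those are smooth again.\<close>

lemma poisson_structure_cong:
  assumes B: "poisson_structure B"
    and eq: "\<And>F G. smooth F \<Longrightarrow> smooth G \<Longrightarrow> B' F G = B F G"
  shows "poisson_structure B'"
proof -
  note B = B[unfolded poisson_structure_def]
  note closed = B[THEN conjunct1, rule_format]
    and linear = B[THEN conjunct2, THEN conjunct1, rule_format]
    and antisym = B[THEN conjunct2, THEN conjunct2, THEN conjunct1, rule_format]
    and leibniz = B[THEN conjunct2, THEN conjunct2, THEN conjunct2, THEN conjunct1, rule_format]
    and jacobi = B[THEN conjunct2, THEN conjunct2, THEN conjunct2, THEN conjunct2, rule_format]
  show ?thesis
    unfolding poisson_structure_def
  proof (intro conjI allI impI)
    fix F G K :: "'a \<Rightarrow> real" and c d z
    assume F: "smooth F" and G: "smooth G"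
    show "smooth (B' F G)"
      unfolding eq[OF F G] by (rule closed[OF F G])
    show "B' F G z = - B' G F z"
      unfolding eq[OF F G] eq[OF G F] by (rule antisym[OF F G])
    assume K: "smooth K"
    have sum: "smooth (\<lambda>y. c * F y + d * G y)" and prod: "smooth (\<lambda>y. F y * G y)"
      by (intro smooth_add smooth_mult smooth_const F G)+
    show "B' (\<lambda>y. c * F y + d * G y) K z = c * B' F K z + d * B' G K z"
      unfolding eq[OF sum K] eq[OF F K] eq[OF G K] by (rule linear[OF F G K])
    show "B' (\<lambda>y. F y * G y) K z = F z * B' G K z + G z * B' F K z"
      unfolding eq[OF prod K] eq[OF F K] eq[OF G K] by (rule leibniz[OF F G K])
    show "B' F (B' G K) z + B' G (B' K F) z + B' K (B' F G) z = 0"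
      unfolding eq[OF F G] eq[OF G K] eq[OF K F]
        eq[OF F closed[OF G K]] eq[OF G closed[OF K F]] eq[OF K closed[OF F G]]
      by (rule jacobi[OF F G K])
  qed
qed

lemma bivector_bracket_GDERIV:
  assumes F: "GDERIV F z :> df" and G: "GDERIV G z :> dg" and J: "linear J"
  shows "bivector_bracket J F G z = df \<bullet> J dg"
proof -
  have J_sum: "J dg = (\<Sum>j\<in>Basis. (j \<bullet> dg) *\<^sub>R J j)"
    using linear_sum[OF J, of "\<lambda>j. (dg \<bullet> j) *\<^sub>R j" Basis]
    by (simp add: euclidean_representation linear_scale[OF J]) (simp add: inner_commute)
  have "df \<bullet> J dg = (\<Sum>i\<in>Basis. (i \<bullet> df) * (i \<bullet> J dg))"
    using euclidean_inner[of df "J dg"] by (simp only: inner_commute)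
  also have "\<dots> = (\<Sum>i\<in>Basis. \<Sum>j\<in>Basis. (i \<bullet> J j) * ((i \<bullet> df) * (j \<bullet> dg)))"
    unfolding J_sum by (simp add: inner_sum_right sum_distrib_left mult_ac)
  finally show ?thesis
    unfolding bivector_bracket_def GDERIV_frechet_derivative[OF F] GDERIV_frechet_derivative[OF G] ..
qed

section \<open>Constant two-forms\<close>

lemma form2_eq_inner: "form2 \<Omega> X Y = X \<bullet> (\<Omega> *v Y)"
  unfolding form2_def inner_vec_def matrix_vector_mult_def
  by (simp add: sum_distrib_left mult_ac)

lemma inner_matrix_vector_mult: "x \<bullet> (A *v y) = (transpose A *v x) \<bullet> y" for x :: "real^'n"
  by (metis dot_lmul_matrix vector_transpose_matrix transpose_transpose)

lemma two_form_transpose: "two_form \<Omega> \<longleftrightarrow> transpose \<Omega> = - \<Omega>"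
  unfolding two_form_def vec_eq_iff transpose_def by auto

lemma matrix_vector_mult_minus_left: "(- A) *v x = - (A *v x)" for A :: "real^'n^'m"
  by (simp add: matrix_vector_mult_def vec_eq_iff sum_negf)

lemma matrix_vector_mult_minus_right: "A *v (- x) = - (A *v x)" for A :: "real^'n^'m"
  by (simp add: matrix_vector_mult_def vec_eq_iff sum_negf)

lemmas matrix_vector_simps = matrix_vector_mult_minus_left matrix_vector_mult_minus_right
  matrix_vector_right_distrib matrix_vector_mult_diff_distrib matrix_vector_mult_scaleR

lemma two_form_skew:
  assumes "two_form \<Omega>"
  shows "(\<Omega> *v u) \<bullet> v = - (u \<bullet> (\<Omega> *v v))"
  using inner_matrix_vector_mult[of v \<Omega> u] assms[unfolded two_form_transpose]
  by (simp only: matrix_vector_mult_minus_left inner_minus_left inner_minus_right inner_commute)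

context
  fixes \<Omega> :: "real^'n^'n"
  assumes two_form: "two_form \<Omega>" and nondegenerate: "nondegenerate \<Omega>"
begin

lemma transpose_raised: "transpose \<Omega> ** raised \<Omega> = mat 1"
  using raised_eq[OF nondegenerate]
  by (simp add: matrix_matrix_mult_def transpose_def mat_def vec_eq_iff)

text \<open>Since \<open>raised\<close> contracts over the first indices and \<open>\<Omega>\<close> is skew, its matrix is minus
  the inverse of \<open>\<Omega>\<close>.\<close>

lemma two_form_raised [simp]: "\<Omega> *v (raised \<Omega> *v u) = - u"
proof -
  have "transpose \<Omega> *v (raised \<Omega> *v u) = u"
    by (simp only: matrix_vector_mul_assoc transpose_raised matrix_vector_mul_lid)
  moreover have "transpose \<Omega> = - \<Omega>" using two_form by (simp only: two_form_transpose)
  ultimately show ?thesis by (simp only: matrix_vector_mult_minus_left minus_equation_iff)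
qed

lemma raised_two_form [simp]: "raised \<Omega> *v (\<Omega> *v u) = - u"
proof -
  have "raised \<Omega> ** transpose \<Omega> = mat 1"
    using transpose_raised by (simp add: matrix_left_right_inverse)
  then have "raised \<Omega> *v (transpose \<Omega> *v u) = u"
    by (simp only: matrix_vector_mul_assoc matrix_vector_mul_lid)
  moreover have "transpose \<Omega> = - \<Omega>" using two_form by (simp only: two_form_transpose)
  ultimately show ?thesis
    by (simp only: matrix_vector_mult_minus_left matrix_vector_mult_minus_right minus_equation_iff)
qed

lemma raised_skew: "(raised \<Omega> *v u) \<bullet> v = - (u \<bullet> (raised \<Omega> *v v))"
  using two_form_skew[OF two_form, of "raised \<Omega> *v u" "raised \<Omega> *v v"] by simp

end

section \<open>The Dirac bracket on the reduced phase space\<close>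

lemma canonical_bracket_GDERIV:
  assumes F: "GDERIV F z :> df" and G: "GDERIV G z :> dg"
  shows "canonical_bracket F G z = fst df \<bullet> snd dg - snd df \<bullet> fst dg"
  unfolding canonical_bracket_def GDERIV_frechet_derivative[OF F] GDERIV_frechet_derivative[OF G]
    sum_subtractf
  using euclidean_inner[of "fst df" "snd dg"] euclidean_inner[of "snd df" "fst dg"]
  by (simp add: inner_commute inner_prod_def)

text \<open>The constraints are linear on phase space, so their gradients do not depend on the point.\<close>

fun constraint_gradient :: "real^'n^'n \<Rightarrow> 'n + 'n + 'n \<Rightarrow> 'n::finite config \<times> 'n config" where
  "constraint_gradient \<Omega> (Inl a) = ((0, 0, - axis a 1), (axis a 1, 0, 0))"
| "constraint_gradient \<Omega> (Inr (Inl a)) = ((0, - (1/2) *\<^sub>R \<Omega> $ a, 0), (0, axis a 1, 0))"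
| "constraint_gradient \<Omega> (Inr (Inr a)) = ((0, 0, 0), (0, 0, axis a 1))"

lemma constraint_eq_inner: "constraint \<Omega> i z = z \<bullet> constraint_gradient \<Omega> i"
proof -
  obtain x U l P R S where z: "z = ((x, U, l), (P, R, S))" by (metis surj_pair)
  show ?thesis
    unfolding z
    by (cases "(\<Omega>, i)" rule: constraint_gradient.cases)
      (simp_all add: constraint_def inner_axis inner_vec_def[of U] mult_ac)
qed

lemma GDERIV_constraint: "GDERIV (constraint \<Omega> i) z :> constraint_gradient \<Omega> i"
  unfolding constraint_eq_inner[abs_def] by (rule GDERIV_inner_left)

text \<open>The constraint matrix couples \<open>P - \<lambda>\<close> only to \<open>S\<close>, through \<open>\<plusminus>1\<close>, and
  \<open>R - \<Omega> U / 2\<close> only to itself, through \<open>-\<Omega>\<close>. It is therefore inverted block by block;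
  the middle block of the inverse is \<open>(-\<Omega>)\<^sup>-\<^sup>1\<close>, the matrix \<open>\<Omega>\<^sup>a\<^sup>b\<close>.\<close>

fun inverse_constraint_entry :: "real^'n^'n \<Rightarrow> 'n + 'n + 'n \<Rightarrow> 'n + 'n + 'n \<Rightarrow> real" where
  "inverse_constraint_entry W (Inl a) (Inr (Inr b)) = (if a = b then 1 else 0)"
| "inverse_constraint_entry W (Inr (Inl a)) (Inr (Inl b)) = W $ a $ b"
| "inverse_constraint_entry W (Inr (Inr a)) (Inl b) = (if a = b then - 1 else 0)"
| "inverse_constraint_entry W _ _ = 0"

lemma sum_UNIV_sum:
  fixes f :: "'a::finite + 'b::finite \<Rightarrow> 'c::comm_monoid_add"
  shows "(\<Sum>i\<in>UNIV. f i) = (\<Sum>a\<in>UNIV. f (Inl a)) + (\<Sum>b\<in>UNIV. f (Inr b))"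
  using sum.Plus[of "UNIV :: 'a set" "UNIV :: 'b set" f] by simp

lemma constraint_matrix_entries:
  assumes "two_form \<Omega>"
  shows
  "constraint_matrix (constraint \<Omega>) z $ Inl a $ Inl b = 0"
  "constraint_matrix (constraint \<Omega>) z $ Inl a $ Inr (Inl b) = 0"
  "constraint_matrix (constraint \<Omega>) z $ Inl a $ Inr (Inr b) = (if a = b then - 1 else 0)"
  "constraint_matrix (constraint \<Omega>) z $ Inr (Inl a) $ Inl b = 0"
  "constraint_matrix (constraint \<Omega>) z $ Inr (Inl a) $ Inr (Inl b) = - \<Omega> $ a $ b"
  "constraint_matrix (constraint \<Omega>) z $ Inr (Inl a) $ Inr (Inr b) = 0"
  "constraint_matrix (constraint \<Omega>) z $ Inr (Inr a) $ Inl b = (if a = b then 1 else 0)"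
  "constraint_matrix (constraint \<Omega>) z $ Inr (Inr a) $ Inr (Inl b) = 0"
  "constraint_matrix (constraint \<Omega>) z $ Inr (Inr a) $ Inr (Inr b) = 0"
proof -
  have entry: "constraint_matrix (constraint \<Omega>) z $ i $ j
    = fst (constraint_gradient \<Omega> i) \<bullet> snd (constraint_gradient \<Omega> j)
      - snd (constraint_gradient \<Omega> i) \<bullet> fst (constraint_gradient \<Omega> j)" for i j
    by (simp add: constraint_matrix_def canonical_bracket_GDERIV[OF GDERIV_constraint GDERIV_constraint])
  have "\<Omega> $ b $ a = - \<Omega> $ a $ b" using assms unfolding two_form_def by blast
  then show
  "constraint_matrix (constraint \<Omega>) z $ Inl a $ Inl b = 0"
  "constraint_matrix (constraint \<Omega>) z $ Inl a $ Inr (Inl b) = 0"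
  "constraint_matrix (constraint \<Omega>) z $ Inl a $ Inr (Inr b) = (if a = b then - 1 else 0)"
  "constraint_matrix (constraint \<Omega>) z $ Inr (Inl a) $ Inl b = 0"
  "constraint_matrix (constraint \<Omega>) z $ Inr (Inl a) $ Inr (Inl b) = - \<Omega> $ a $ b"
  "constraint_matrix (constraint \<Omega>) z $ Inr (Inl a) $ Inr (Inr b) = 0"
  "constraint_matrix (constraint \<Omega>) z $ Inr (Inr a) $ Inl b = (if a = b then 1 else 0)"
  "constraint_matrix (constraint \<Omega>) z $ Inr (Inr a) $ Inr (Inl b) = 0"
  "constraint_matrix (constraint \<Omega>) z $ Inr (Inr a) $ Inr (Inr b) = 0"
    unfolding entry
    by (simp_all add: inner_axis inner_axis') (auto simp: axis_def)
qed

lemma constraint_matrix_inverse: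
  fixes \<Omega> :: "real^'n^'n"
  assumes "two_form \<Omega>" "nondegenerate \<Omega>"
  shows "invertible (constraint_matrix (constraint \<Omega>) z)"
    and "matrix_inv (constraint_matrix (constraint \<Omega>) z)
      = (\<chi> i j. inverse_constraint_entry (raised \<Omega>) i j)"
proof -
  let ?M = "constraint_matrix (constraint \<Omega>) z"
  let ?N = "\<chi> i j. inverse_constraint_entry (raised \<Omega>) i j"
  have skew: "\<Omega> $ a $ b = - \<Omega> $ b $ a" for a b
    using assms(1) unfolding two_form_def by blast
  have "(\<Sum>c\<in>UNIV. - \<Omega> $ a $ c * raised \<Omega> $ c $ b) = (if a = b then 1 else 0)" for a b
    using raised_eq[OF assms(2), of a b] by (simp add: skew[of a])
  then have "(\<Sum>k\<in>UNIV. ?M $ i $ k * ?N $ k $ j) = (if i = j then 1 else 0)" for i j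
    by (cases "(\<Omega>, i)" rule: constraint_gradient.cases;
        cases "(\<Omega>, j)" rule: constraint_gradient.cases)
      (simp_all add: sum_UNIV_sum constraint_matrix_entries[OF assms(1)] if_distrib if_distribR
        cong: if_cong)
  then have MN: "?M ** ?N = mat 1"
    by (simp add: matrix_matrix_mult_def mat_def vec_eq_iff)
  then have NM: "?N ** ?M = mat 1"
    by (simp add: matrix_left_right_inverse)
  show inv: "invertible ?M"
    unfolding invertible_def using MN NM by blast
  have "?M ** matrix_inv ?M = mat 1 \<and> matrix_inv ?M ** ?M = mat 1"
    using inv unfolding invertible_def matrix_inv_def by (rule someI_ex)
  then have "?M ** matrix_inv ?M = mat 1" ..
  then have "?N ** (?M ** matrix_inv ?M) = ?N" by (simp only: matrix_mul_rid)
  then show "matrix_inv ?M = ?N" by (simp only: matrix_mul_assoc NM matrix_mul_lid)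
qed

lemma reduced_coords_surface_point [simp]: "reduced_coords (surface_point \<Omega> z) = z"
  by (cases z) (simp add: reduced_coords_def surface_point_def)

lemma GDERIV_reduced_coords:
  assumes "GDERIV f (reduced_coords z) :> (fx, fU, fP)"
  shows "GDERIV (f \<circ> reduced_coords) z :> ((fx, fU, 0), (fP, 0, 0))"
proof -
  have rc: "reduced_coords = (\<lambda>z. (fst (fst z), fst (snd (fst z)), fst (snd z)))"
    by (auto simp: reduced_coords_def)
  have "(reduced_coords has_derivative reduced_coords) (at z)"
    unfolding rc by (intro derivative_intros has_derivative_fst has_derivative_snd has_derivative_ident)
  from has_derivative_compose[OF this assms[unfolded gderiv_def]]
  show ?thesis
    unfolding gderiv_def o_def
    by (rule has_derivative_eq_rhs) (auto simp: rc)
qed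

text \<open>A function of \<open>(x, U, P)\<close> commutes with the constraints \<open>S\<close>, so in the Dirac correction the
  blocks coupling \<open>P - \<lambda>\<close> and \<open>S\<close> drop out. What remains of the correction is the
  \<open>U\<close>-term with \<open>\<Omega>\<^sup>a\<^sup>b\<close>; the canonical bracket contributes the \<open>x\<close>-\<open>P\<close> terms.\<close>

lemma reduced_bracket_GDERIV:
  fixes \<Omega> :: "real^'n^'n"
  assumes "two_form \<Omega>" "nondegenerate \<Omega>"
    and f: "GDERIV f z :> (fx, fU, fP)" and g: "GDERIV g z :> (gx, gU, gP)"
  shows "reduced_bracket \<Omega> f g z = fx \<bullet> gP - fP \<bullet> gx + fU \<bullet> (raised \<Omega> *v gU)"
proof -
  define s where "s = surface_point \<Omega> z"
  have f': "GDERIV (f \<circ> reduced_coords) s :> ((fx, fU, 0), (fP, 0, 0))"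
    and g': "GDERIV (g \<circ> reduced_coords) s :> ((gx, gU, 0), (gP, 0, 0))"
    unfolding s_def by (rule GDERIV_reduced_coords, simp add: f g)+
  note con = GDERIV_constraint[of \<Omega> "Inl _" s] GDERIV_constraint[of \<Omega> "Inr (Inl _)" s]
    GDERIV_constraint[of \<Omega> "Inr (Inr _)" s]
  note con = con[unfolded constraint_gradient.simps]
  have fcon: "canonical_bracket (f \<circ> reduced_coords) (constraint \<Omega> (Inl a)) s = fx $ a"
    "canonical_bracket (f \<circ> reduced_coords) (constraint \<Omega> (Inr (Inl a))) s = fU $ a"
    "canonical_bracket (f \<circ> reduced_coords) (constraint \<Omega> (Inr (Inr a))) s = 0" for a
    by (simp_all add: canonical_bracket_GDERIV[OF f' con(1)] canonical_bracket_GDERIV[OF f' con(2)]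
        canonical_bracket_GDERIV[OF f' con(3)] inner_axis)
  have gcon: "canonical_bracket (constraint \<Omega> (Inl a)) (g \<circ> reduced_coords) s = - gx $ a"
    "canonical_bracket (constraint \<Omega> (Inr (Inl a))) (g \<circ> reduced_coords) s = - gU $ a"
    "canonical_bracket (constraint \<Omega> (Inr (Inr a))) (g \<circ> reduced_coords) s = 0" for a
    by (simp_all add: canonical_bracket_GDERIV[OF con(1) g'] canonical_bracket_GDERIV[OF con(2) g']
        canonical_bracket_GDERIV[OF con(3) g'] inner_axis')
  show ?thesis
    unfolding reduced_bracket_def dirac_bracket_def s_def[symmetric]
    by (simp add: constraint_matrix_inverse(2)[OF assms(1,2)] sum_UNIV_sum fcon gcon
        canonical_bracket_GDERIV[OF f' g'] inner_vec_def[of fU] matrix_vector_mult_def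
        sum_distrib_left sum_negf mult_ac)
qed

section \<open>The Legendre transform\<close>

lemma legendre_momentum_GDERIV:
  assumes "GDERIV (\<L> q) v :> p"
  shows "legendre_momentum \<L> q v = p"
  unfolding legendre_momentum_def GDERIV_frechet_derivative[OF assms]
  using euclidean_representation[of p] by (simp add: inner_commute)

text \<open>The first-order Lagrangian is affine in the velocities, so the momenta are its coefficients and
  do not depend on the velocities: this is the origin of the constraints.\<close>

lemma legendre_momentum_lagrangian1:
  "legendre_momentum (lagrangian1 w \<phi> \<Omega>) (x, U, l) v = (l, (1/2) *\<^sub>R (\<Omega> *v U), 0)"
proof (rule legendre_momentum_GDERIV)
  have "lagrangian1 w \<phi> \<Omega> (x, U, l) v
    = v \<bullet> (l, (1/2) *\<^sub>R (\<Omega> *v U), 0) + (w\<^sup>2 * (\<phi> x \<bullet> U) - l \<bullet> U)" for v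
    by (cases v) (simp add: lagrangian1_def lagrangian2_def form2_eq_inner inner_diff_right inner_commute)
  then have "lagrangian1 w \<phi> \<Omega> (x, U, l)
    = (\<lambda>v. v \<bullet> (l, (1/2) *\<^sub>R (\<Omega> *v U), 0) + (w\<^sup>2 * (\<phi> x \<bullet> U) - l \<bullet> U))" ..
  then show "GDERIV (lagrangian1 w \<phi> \<Omega> (x, U, l)) v :> (l, (1/2) *\<^sub>R (\<Omega> *v U), 0)"
    using GDERIV_add[OF GDERIV_inner_left GDERIV_const] by simp
qed

lemma reduced_hamiltonian_eq: "reduced_hamiltonian w \<phi> (x, U, P) = (P - w\<^sup>2 *\<^sub>R \<phi> x) \<bullet> U"
  by (simp add: reduced_hamiltonian_def inner_vec_def)

lemma legendre_energy_lagrangian1: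
  "legendre_energy (lagrangian1 w \<phi> \<Omega>) (x, U, l) v = reduced_hamiltonian w \<phi> (x, U, l)"
proof -
  obtain x' U' l' where v: "v = (x', U', l')" by (metis surj_pair)
  show ?thesis
    unfolding legendre_energy_def legendre_momentum_lagrangian1 reduced_hamiltonian_eq v
    by (simp add: lagrangian1_def lagrangian2_def form2_eq_inner inner_diff_left inner_diff_right
        inner_commute)
qed

lemma constraint_surface_eq_range: "constraint_surface \<Omega> = range (surface_point \<Omega>)"
proof (intro set_eqI iffI)
  fix z
  assume "z \<in> constraint_surface \<Omega>"
  then have con: "constraint \<Omega> i z = 0" for i by (simp add: constraint_surface_def)
  obtain x U l P R S where z: "z = ((x, U, l), (P, R, S))" by (metis surj_pair)
  have "P $ a = l $ a" "R $ a = 1/2 * (\<Sum>b\<in>UNIV. \<Omega> $ a $ b * U $ b)" "S $ a = 0" for a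
    using con[of "Inl a"] con[of "Inr (Inl a)"] con[of "Inr (Inr a)"]
    by (simp_all add: z constraint_def)
  then have "z = surface_point \<Omega> (x, U, P)"
    by (simp add: z surface_point_def vec_eq_iff matrix_vector_mult_def)
  then show "z \<in> range (surface_point \<Omega>)" by blast
next
  fix z
  assume "z \<in> range (surface_point \<Omega>)"
  then obtain x U P where "z = surface_point \<Omega> (x, U, P)" by auto
  then show "z \<in> constraint_surface \<Omega>"
    by (auto simp: constraint_surface_def constraint_def surface_point_def matrix_vector_mult_def
        split: sum.split)
qed

lemma legendre_image:
  "{(q, p). \<exists>v. p = legendre_momentum (lagrangian1 w \<phi> \<Omega>) q v} = range (surface_point \<Omega>)"
  by (auto simp: surface_point_def legendre_momentum_lagrangian1 image_iff)

section \<open>The bracket in the coordinates \<open>(x, U, A)\<close>\<close>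

lemma has_derivative_jacobian:
  fixes \<phi> :: "real^'n \<Rightarrow> real^'m"
  assumes "\<phi> differentiable (at x)"
  shows "(\<phi> has_derivative (\<lambda>h. matrix (frechet_derivative \<phi> (at x)) *v h)) (at x)"
proof -
  have "(\<phi> has_derivative frechet_derivative \<phi> (at x)) (at x)"
    using assms by (rule iffD1[OF frechet_derivative_works])
  moreover from this have "\<And>h. frechet_derivative \<phi> (at x) h = matrix (frechet_derivative \<phi> (at x)) *v h"
    by (simp add: matrix_works has_derivative_linear)
  ultimately show ?thesis by (rule has_derivative_eq_rhs[OF _ ext])
qed

lemma exterior_deriv_jacobian:
  fixes \<phi> :: "real^'n \<Rightarrow> real^'n"
  assumes D: "(\<phi> has_derivative (\<lambda>h. D *v h)) (at x)"
  shows "exterior_deriv \<phi> x = transpose D - D"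
proof -
  have "partial_deriv a (\<lambda>y. \<phi> y $ b) x = D $ b $ a" for a b
  proof -
    have "((\<lambda>y. \<phi> y $ b) has_derivative (\<lambda>h. (D *v h) $ b)) (at x)"
      by (rule bounded_linear.has_derivative[OF bounded_linear_vec_nth D])
    from frechet_derivative_eqI[OF this, of "axis a 1"] show ?thesis
      unfolding partial_deriv_def by (simp add: matrix_vector_mult_basis column_def)
  qed
  then show ?thesis by (simp add: exterior_deriv_def transpose_def vec_eq_iff)
qed

text \<open>The asserted brackets of the coordinates, written as the map that takes the gradient of a Hamiltonian
  to its Hamiltonian vector field; \<open>W\<close> stands for \<open>\<Omega>\<^sup>a\<^sup>b\<close>.\<close>

definition hamiltonian_map :: "real \<Rightarrow> real^'n^'n \<Rightarrow> 'n jet2 \<Rightarrow> 'n::finite jet2" where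
  "hamiltonian_map w W = (\<lambda>(a, b, c). (- (W *v c), W *v b, w\<^sup>2 *\<^sub>R (W *v c) - W *v a))"

lemma linear_hamiltonian_map: "linear (hamiltonian_map w W)"
  by (rule linearI) (auto simp: hamiltonian_map_def matrix_vector_simps algebra_simps)

locale symplectic_potential =
  fixes \<Omega> :: "real^'n^'n" and \<phi> :: "real^'n \<Rightarrow> real^'n" and w :: real
  assumes two_form: "two_form \<Omega>" and nondegenerate: "nondegenerate \<Omega>"
    and smooth: "smooth \<phi>" and d\<phi>: "\<And>x. exterior_deriv \<phi> x = \<Omega>"
begin

abbreviation "W \<equiv> raised \<Omega>"
abbreviation "T \<equiv> to_jet2 w \<phi> \<Omega>"

lemmas W_inverse [simp] = two_form_raised[OF two_form nondegenerate]
  raised_two_form[OF two_form nondegenerate]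
lemmas W_skew = raised_skew[OF two_form nondegenerate]

lemma potential_derivative:
  obtains D where "(\<phi> has_derivative (\<lambda>h. D *v h)) (at x)" "transpose D - D = \<Omega>"
  using has_derivative_jacobian[OF smooth_differentiable[OF smooth]] exterior_deriv_jacobian d\<phi>
  by metis

text \<open>The \<open>x\<close>-component of the gradient is left unspecified: \<open>{U\<^sup>a, H}\<close> involves
  only the \<open>U\<close>-component.\<close>

lemma GDERIV_reduced_hamiltonian:
  obtains h where "GDERIV (reduced_hamiltonian w \<phi>) (x, U, P) :> (h, P - w\<^sup>2 *\<^sub>R \<phi> x, U)"
proof -
  obtain D where D: "(\<phi> has_derivative (\<lambda>h. D *v h)) (at x)" by (rule potential_derivative)
  have H: "reduced_hamiltonian w \<phi> = (\<lambda>z. (snd (snd z) - w\<^sup>2 *\<^sub>R \<phi> (fst z)) \<bullet> fst (snd z))"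
    by (auto simp: reduced_hamiltonian_eq)
  have \<phi>: "((\<lambda>z. \<phi> (fst z)) has_derivative (\<lambda>h. D *v fst h)) (at (x, U, P))"
    by (rule has_derivative_compose[where f = fst and g = \<phi>, simplified])
      (auto intro!: derivative_intros D)
  have "((\<lambda>z. (snd (snd z) - w\<^sup>2 *\<^sub>R \<phi> (fst z)) \<bullet> fst (snd z)) has_derivative
     (\<lambda>h. (snd (snd (x, U, P)) - w\<^sup>2 *\<^sub>R \<phi> (fst (x, U, P))) \<bullet> fst (snd h)
       + (snd (snd h) - w\<^sup>2 *\<^sub>R (D *v fst h)) \<bullet> fst (snd (x, U, P)))) (at (x, U, P))"
    by (intro has_derivative_inner has_derivative_diff has_derivative_scaleR_right \<phi>
        has_derivative_fst has_derivative_snd has_derivative_ident)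
  moreover have "(snd (snd (x, U, P)) - w\<^sup>2 *\<^sub>R \<phi> (fst (x, U, P))) \<bullet> fst (snd h)
       + (snd (snd h) - w\<^sup>2 *\<^sub>R (D *v fst h)) \<bullet> fst (snd (x, U, P))
     = h \<bullet> (- w\<^sup>2 *\<^sub>R (transpose D *v U), P - w\<^sup>2 *\<^sub>R \<phi> x, U)" for h
  proof -
    obtain dx dU dP where h: "h = (dx, dU, dP)" by (metis surj_pair)
    have "(D *v dx) \<bullet> U = dx \<bullet> (transpose D *v U)"
      using inner_matrix_vector_mult[of U D dx] by (simp only: inner_commute)
    then show ?thesis
      by (simp add: h inner_diff_left inner_diff_right inner_commute del: vector_transpose_matrix transpose_matrix_vector)
  qed
  ultimately have "GDERIV (\<lambda>z. (snd (snd z) - w\<^sup>2 *\<^sub>R \<phi> (fst z)) \<bullet> fst (snd z)) (x, U, P)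
      :> (- w\<^sup>2 *\<^sub>R (transpose D *v U), P - w\<^sup>2 *\<^sub>R \<phi> x, U)"
    unfolding gderiv_def by (rule has_derivative_eq_rhs[OF _ ext])
  then show thesis
    using that unfolding H by blast
qed

lemma to_jet2_eq: "T (x, U, P) = (x, U, W *v (P - w\<^sup>2 *\<^sub>R \<phi> x))"
proof -
  obtain h where H: "GDERIV (reduced_hamiltonian w \<phi>) (x, U, P) :> (h, P - w\<^sup>2 *\<^sub>R \<phi> x, U)"
    by (rule GDERIV_reduced_hamiltonian)
  have "GDERIV (\<lambda>(y, V, Q). V $ a) (x, U, P) :> (0, axis a 1, 0)" for a
  proof -
    have "(\<lambda>(y, V, Q). V $ a) = (\<lambda>z :: 'n reduced. z \<bullet> (0, axis a 1, 0))"
      by (auto simp: inner_axis)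
    then show ?thesis using GDERIV_inner_left by metis
  qed
  from reduced_bracket_GDERIV[OF two_form nondegenerate this H]
  show ?thesis
    by (simp add: to_jet2_def vec_eq_iff inner_axis')
qed

lemma to_jet2_from_jet2: "T (x, U, w\<^sup>2 *\<^sub>R \<phi> x - \<Omega> *v A) = (x, U, A)"
  by (simp add: to_jet2_eq matrix_vector_simps)

lemma bij_to_jet2: "bij T"
proof (rule bijI)
  show "inj T"
  proof (rule injI, clarsimp simp: to_jet2_eq)
    fix x P Q
    assume "W *v (P - w\<^sup>2 *\<^sub>R \<phi> x) = W *v (Q - w\<^sup>2 *\<^sub>R \<phi> x)"
    then have "\<Omega> *v (W *v (P - w\<^sup>2 *\<^sub>R \<phi> x)) = \<Omega> *v (W *v (Q - w\<^sup>2 *\<^sub>R \<phi> x))" by simp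
    then show "P = Q" by simp
  qed
  show "surj T"
    by (rule surjI[of _ "\<lambda>(x, U, A). (x, U, w\<^sup>2 *\<^sub>R \<phi> x - \<Omega> *v A)"])
      (auto simp: to_jet2_from_jet2)
qed

lemma to_jet2_inv [simp]: "T (inv T y) = y"
  using bij_to_jet2 by (simp add: bij_is_surj surj_f_inv_f)

text \<open>The transpose of the derivative of \<open>T\<close>. The terms in \<open>D\<close>, the Jacobian of \<open>\<phi>\<close>,
  arise because \<open>A\<close> depends on \<open>x\<close> through \<open>\<phi>\<close>.\<close>

lemma GDERIV_to_jet2:
  assumes D: "(\<phi> has_derivative (\<lambda>h. D *v h)) (at (fst z))"
    and F: "GDERIV F (T z) :> (a, b, c)"
  shows "GDERIV (F \<circ> T) z :> (a + w\<^sup>2 *\<^sub>R (transpose D *v (W *v c)), b, - (W *v c))"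
proof -
  have T: "T = (\<lambda>z. (fst z, fst (snd z), W *v (snd (snd z) - w\<^sup>2 *\<^sub>R \<phi> (fst z))))"
    by (auto simp: to_jet2_eq)
  have \<phi>: "((\<lambda>z. \<phi> (fst z)) has_derivative (\<lambda>h. D *v fst h)) (at z)"
    by (rule has_derivative_compose[where f = fst and g = \<phi>, simplified])
      (auto intro!: derivative_intros D)
  have "(T has_derivative (\<lambda>h. (fst h, fst (snd h), W *v (snd (snd h) - w\<^sup>2 *\<^sub>R (D *v fst h))))) (at z)"
    unfolding T
    by (intro has_derivative_Pair has_derivative_diff has_derivative_scaleR_right \<phi>
        has_derivative_fst has_derivative_snd has_derivative_ident
        bounded_linear.has_derivative[OF matrix_vector_mul_bounded_linear])
  from has_derivative_compose[OF this F[unfolded gderiv_def]]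
  show ?thesis
    unfolding gderiv_def o_def
  proof (rule has_derivative_eq_rhs, intro ext)
    fix h :: "'n reduced"
    obtain dx dU dP where h: "h = (dx, dU, dP)" by (metis surj_pair)
    have "(W *v (dP - w\<^sup>2 *\<^sub>R (D *v dx))) \<bullet> c = - (dP \<bullet> (W *v c)) + w\<^sup>2 * ((D *v dx) \<bullet> (W *v c))"
      unfolding W_skew by (simp add: inner_diff_left)
    also have "(D *v dx) \<bullet> (W *v c) = dx \<bullet> (transpose D *v (W *v c))"
      using inner_matrix_vector_mult[of "W *v c" D dx] by (simp only: inner_commute)
    finally show "(fst h, fst (snd h), W *v (snd (snd h) - w\<^sup>2 *\<^sub>R (D *v fst h))) \<bullet> (a, b, c)
      = h \<bullet> (a + w\<^sup>2 *\<^sub>R (transpose D *v (W *v c)), b, - (W *v c))"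
      by (simp only: h fst_conv snd_conv inner_Pair inner_add_right inner_scaleR_right inner_minus_right)
  qed
qed

text \<open>After the change of coordinates the only terms that could depend on the point are those in the
  Jacobian \<open>D\<close> of \<open>\<phi>\<close>. They enter through \<open>D\<^sup>T - D\<close>, that is through
  \<open>d\<phi> = \<Omega>\<close>, which is constant, and produce the bracket \<open>{A\<^sup>a, A\<^sup>b} = w\<^sup>2 \<Omega>\<^sup>a\<^sup>b\<close>.\<close>

lemma induced_bracket_GDERIV:
  assumes F: "GDERIV F y :> df" and G: "GDERIV G y :> dg"
  shows "induced_bracket w \<phi> \<Omega> F G y = df \<bullet> hamiltonian_map w W dg"
proof -
  obtain fx fU fA gx gU gA where f: "df = (fx, fU, fA)" and g: "dg = (gx, gU, gA)"
    by (metis surj_pair)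
  define z where "z = inv T y"
  have y: "T z = y" by (simp add: z_def)
  obtain D where D: "(\<phi> has_derivative (\<lambda>h. D *v h)) (at (fst z))" and \<Omega>: "transpose D - D = \<Omega>"
    by (rule potential_derivative)
  let ?p = "W *v fA" and ?q = "W *v gA"
  have "induced_bracket w \<phi> \<Omega> F G y
    = (fx + w\<^sup>2 *\<^sub>R (transpose D *v ?p)) \<bullet> (- ?q) - (- ?p) \<bullet> (gx + w\<^sup>2 *\<^sub>R (transpose D *v ?q))
      + fU \<bullet> (W *v gU)"
    unfolding induced_bracket_def z_def[symmetric]
    by (rule reduced_bracket_GDERIV[OF two_form nondegenerate
          GDERIV_to_jet2[OF D F[folded y, unfolded f]] GDERIV_to_jet2[OF D G[folded y, unfolded g]]])
  also have "\<dots> = - (fx \<bullet> ?q) + ?p \<bullet> gx + fU \<bullet> (W *v gU)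
      + w\<^sup>2 * (?p \<bullet> (transpose D *v ?q) - (transpose D *v ?p) \<bullet> ?q)"
    by (simp only: inner_add_left inner_add_right inner_minus_left inner_minus_right
        inner_scaleR_left inner_scaleR_right) (simp only: algebra_simps)
  also have "(transpose D *v ?p) \<bullet> ?q = ?p \<bullet> (D *v ?q)"
    by (rule inner_matrix_vector_mult[symmetric])
  also have "?p \<bullet> (transpose D *v ?q) - ?p \<bullet> (D *v ?q) = ?p \<bullet> (\<Omega> *v ?q)"
    unfolding \<Omega>[symmetric] by (simp only: matrix_vector_mult_diff_rdistrib inner_diff_right)
  also have "\<dots> = fA \<bullet> (W *v gA)"
    by (simp add: W_skew)
  also have "?p \<bullet> gx = - (fA \<bullet> (W *v gx))" by (rule W_skew)
  finally show ?thesis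
    by (simp add: f g hamiltonian_map_def inner_diff_right algebra_simps)
qed

lemma induced_bracket_eq_bivector_bracket:
  assumes "smooth F" "smooth G"
  shows "induced_bracket w \<phi> \<Omega> F G = bivector_bracket (hamiltonian_map w W) F G"
proof
  fix y
  obtain df dg where "GDERIV F y :> df" "GDERIV G y :> dg"
    using assms by (meson differentiable_GDERIV smooth_differentiable)
  then show "induced_bracket w \<phi> \<Omega> F G y = bivector_bracket (hamiltonian_map w W) F G y"
    by (simp add: induced_bracket_GDERIV bivector_bracket_GDERIV linear_hamiltonian_map)
qed

lemma hamiltonian_map_skew: "u \<bullet> hamiltonian_map w W v = - (v \<bullet> hamiltonian_map w W u)"
proof -
  have W: "b \<bullet> (W *v a) = - (a \<bullet> (W *v b))" for a b
    using W_skew[of a b] by (simp add: inner_commute)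
  obtain a b c a' b' c' where u: "u = (a, b, c)" and v: "v = (a', b', c')"
    by (metis surj_pair)
  show ?thesis
    by (simp add: u v hamiltonian_map_def inner_diff_right W[of a c'] W[of c a'] W[of b b'] W[of c c'])
qed

lemma poisson_structure_induced_bracket: "poisson_structure (induced_bracket w \<phi> \<Omega>)"
  by (rule poisson_structure_cong[OF bivector_bracket_poisson_structure
        induced_bracket_eq_bivector_bracket])
    (rule hamiltonian_map_skew)

lemma GDERIV_coords:
  "GDERIV (x_coord a) y :> (axis a 1, 0, 0)"
  "GDERIV (U_coord a) y :> (0, axis a 1, 0)"
  "GDERIV (A_coord a) y :> (0, 0, axis a 1)"
proof -
  have "x_coord a = (\<lambda>y. y \<bullet> (axis a 1, 0, 0))" "U_coord a = (\<lambda>y. y \<bullet> (0, axis a 1, 0))"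
    "A_coord a = (\<lambda>y. y \<bullet> (0, 0, axis a 1))"
    by (auto simp: x_coord_def U_coord_def A_coord_def inner_axis)
  then show
    "GDERIV (x_coord a) y :> (axis a 1, 0, 0)"
    "GDERIV (U_coord a) y :> (0, axis a 1, 0)"
    "GDERIV (A_coord a) y :> (0, 0, axis a 1)"
    by (simp_all only: GDERIV_inner_left)
qed

lemma induced_bracket_coords:
  "induced_bracket w \<phi> \<Omega> (x_coord a) (A_coord b) y = - W $ a $ b"
  "induced_bracket w \<phi> \<Omega> (U_coord a) (U_coord b) y = W $ a $ b"
  "induced_bracket w \<phi> \<Omega> (A_coord a) (A_coord b) y = w\<^sup>2 * W $ a $ b"
  "induced_bracket w \<phi> \<Omega> (x_coord a) (x_coord b) y = 0"
  "induced_bracket w \<phi> \<Omega> (x_coord a) (U_coord b) y = 0"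
  "induced_bracket w \<phi> \<Omega> (U_coord a) (A_coord b) y = 0"
  by (simp_all add: induced_bracket_GDERIV[OF GDERIV_coords(1) GDERIV_coords(1)]
      induced_bracket_GDERIV[OF GDERIV_coords(1) GDERIV_coords(2)]
      induced_bracket_GDERIV[OF GDERIV_coords(1) GDERIV_coords(3)]
      induced_bracket_GDERIV[OF GDERIV_coords(2) GDERIV_coords(2)]
      induced_bracket_GDERIV[OF GDERIV_coords(2) GDERIV_coords(3)]
      induced_bracket_GDERIV[OF GDERIV_coords(3) GDERIV_coords(3)]
      hamiltonian_map_def inner_axis' matrix_vector_mult_basis column_def)

lemma GDERIV_jet2_hamiltonian: "GDERIV (jet2_hamiltonian \<Omega>) (x, U, A) :> (0, - (\<Omega> *v A), \<Omega> *v U)"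
proof -
  have H: "jet2_hamiltonian \<Omega> = (\<lambda>y. snd (snd y) \<bullet> (\<Omega> *v fst (snd y)))"
    by (auto simp: jet2_hamiltonian_def form2_eq_inner)
  have "((\<lambda>y. snd (snd y) \<bullet> (\<Omega> *v fst (snd y))) has_derivative
    (\<lambda>h. snd (snd (x, U, A)) \<bullet> (\<Omega> *v fst (snd h)) + snd (snd h) \<bullet> (\<Omega> *v fst (snd (x, U, A))))) (at (x, U, A))"
    by (intro has_derivative_inner has_derivative_fst has_derivative_snd has_derivative_ident
        bounded_linear.has_derivative[OF matrix_vector_mul_bounded_linear])
  then show ?thesis
    unfolding gderiv_def H
  proof (rule has_derivative_eq_rhs, intro ext)
    fix h :: "'n jet2"
    have "A \<bullet> (\<Omega> *v fst (snd h)) = - (fst (snd h) \<bullet> (\<Omega> *v A))"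
      using two_form_skew[OF two_form, of A "fst (snd h)"] by (simp add: inner_commute)
    then show "snd (snd (x, U, A)) \<bullet> (\<Omega> *v fst (snd h)) + snd (snd h) \<bullet> (\<Omega> *v fst (snd (x, U, A)))
      = h \<bullet> (0, - (\<Omega> *v A), \<Omega> *v U)"
      by (simp add: inner_prod_def)
  qed
qed

text \<open>The gradient of \<open>\<Omega>(A, U)\<close> is \<open>(0, -\<Omega> A, \<Omega> U)\<close>, and \<open>W \<Omega> = -1\<close> turns it into the
  vector field of the third-order equation.\<close>

lemma hamiltonian_vector_field:
  assumes "GDERIV F (x, U, A) :> df"
  shows "induced_bracket w \<phi> \<Omega> F (jet2_hamiltonian \<Omega>) (x, U, A) = df \<bullet> (U, A, - (w\<^sup>2) *\<^sub>R U)"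
  unfolding induced_bracket_GDERIV[OF assms GDERIV_jet2_hamiltonian]
  by (simp add: hamiltonian_map_def matrix_vector_simps)

lemma jet2_hamiltonian_to_jet2: "jet2_hamiltonian \<Omega> (T z) = reduced_hamiltonian w \<phi> z"
proof -
  obtain x U P where z: "z = (x, U, P)" by (metis surj_pair)
  show ?thesis
    by (simp add: z to_jet2_eq jet2_hamiltonian_def form2_eq_inner reduced_hamiltonian_eq W_skew)
qed

end

section \<open>Hamilton's equations\<close>

text \<open>One direction is the chain rule; for the other the linear functions \<open>y \<mapsto> y \<bullet> i\<close>, over basis vectors
  \<open>i\<close>, already determine the derivative of the curve.\<close>

lemma has_vector_derivative_iff_observables:
  fixes \<gamma> :: "real \<Rightarrow> 'a::euclidean_space"
  shows "(\<gamma> has_vector_derivative v) (at t) \<longleftrightarrow>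
    (\<forall>F. smooth F \<longrightarrow>
      ((\<lambda>s. F (\<gamma> s)) has_real_derivative frechet_derivative F (at (\<gamma> t)) v) (at t))"
proof (intro iffI allI impI)
  fix F :: "'a \<Rightarrow> real"
  assume \<gamma>: "(\<gamma> has_vector_derivative v) (at t)" and "smooth F"
  then have F: "(F has_derivative frechet_derivative F (at (\<gamma> t))) (at (\<gamma> t))"
    using smooth_differentiable iffD1[OF frechet_derivative_works] by blast
  have "((\<lambda>s. F (\<gamma> s)) has_derivative (\<lambda>h. frechet_derivative F (at (\<gamma> t)) (h *\<^sub>R v))) (at t)"
    by (rule has_derivative_compose[OF \<gamma>[unfolded has_vector_derivative_def] F])
  then show "((\<lambda>s. F (\<gamma> s)) has_real_derivative frechet_derivative F (at (\<gamma> t)) v) (at t)"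
    unfolding has_field_derivative_def
    by (rule has_derivative_eq_rhs) (auto simp: linear_scale[OF has_derivative_linear[OF F]])
next
  assume obs: "\<forall>F. smooth F \<longrightarrow>
      ((\<lambda>s. F (\<gamma> s)) has_real_derivative frechet_derivative F (at (\<gamma> t)) v) (at t)"
  have "((\<lambda>s. \<gamma> s \<bullet> i) has_derivative (\<lambda>h. (h *\<^sub>R v) \<bullet> i)) (at t)" for i
  proof -
    have "smooth (\<lambda>y :: 'a. y \<bullet> i)"
      by (rule smooth_bounded_linear[OF bounded_linear_inner_left])
    with obs have "((\<lambda>s. \<gamma> s \<bullet> i) has_real_derivative frechet_derivative (\<lambda>y. y \<bullet> i) (at (\<gamma> t)) v) (at t)"
      by blast
    then show ?thesis
      unfolding GDERIV_frechet_derivative[OF GDERIV_inner_left] has_field_derivative_def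
      by (rule has_derivative_eq_rhs) (simp add: fun_eq_iff mult.commute)
  qed
  then show "(\<gamma> has_vector_derivative v) (at t)"
    unfolding has_vector_derivative_def
    using has_derivative_componentwise_within[of \<gamma> "\<lambda>h. h *\<^sub>R v" t UNIV] by blast
qed

lemma has_vector_derivative_Pair_iff:
  "((\<lambda>t. (f t, g t)) has_vector_derivative (f', g')) (at t) \<longleftrightarrow>
    (f has_vector_derivative f') (at t) \<and> (g has_vector_derivative g') (at t)"
  using bounded_linear.has_vector_derivative[OF bounded_linear_fst, of "\<lambda>t. (f t, g t)" "(f', g')"]
    bounded_linear.has_vector_derivative[OF bounded_linear_snd, of "\<lambda>t. (f t, g t)" "(f', g')"]
  by (auto intro: has_vector_derivative_Pair)

context symplectic_potential
begin

text \<open>Hamilton's equations for all observables say that the curve is an integral curve of the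
  Hamiltonian vector field, whose three components are the equations below.\<close>

lemma hamilton_equations_iff:
  "hamilton_equations (induced_bracket w \<phi> \<Omega>) (jet2_hamiltonian \<Omega>) I (\<lambda>t. (X t, U t, A t)) \<longleftrightarrow>
    (\<forall>t\<in>I. (X has_vector_derivative U t) (at t) \<and>
      (U has_vector_derivative A t) (at t) \<and>
      (A has_vector_derivative - (w\<^sup>2) *\<^sub>R U t) (at t))"
proof -
  have "induced_bracket w \<phi> \<Omega> F (jet2_hamiltonian \<Omega>) (x, u, a)
    = frechet_derivative F (at (x, u, a)) (u, a, - (w\<^sup>2) *\<^sub>R u)" if F: "smooth F" for F x u a
  proof -
    obtain df where df: "GDERIV F (x, u, a) :> df"
      using differentiable_GDERIV[OF smooth_differentiable[OF F]] .
    show ?thesis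
      unfolding hamiltonian_vector_field[OF df] GDERIV_frechet_derivative[OF df]
      by (rule inner_commute)
  qed
  then have "hamilton_equations (induced_bracket w \<phi> \<Omega>) (jet2_hamiltonian \<Omega>) I (\<lambda>t. (X t, U t, A t)) \<longleftrightarrow>
    (\<forall>t\<in>I. \<forall>F. smooth F \<longrightarrow> ((\<lambda>s. F (X s, U s, A s)) has_real_derivative
       frechet_derivative F (at (X t, U t, A t)) (U t, A t, - (w\<^sup>2) *\<^sub>R U t)) (at t))"
    unfolding hamilton_equations_def by auto
  also have "\<dots> \<longleftrightarrow> (\<forall>t\<in>I. ((\<lambda>t. (X t, U t, A t)) has_vector_derivative
      (U t, A t, - (w\<^sup>2) *\<^sub>R U t)) (at t))"
    unfolding has_vector_derivative_iff_observables ..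
  finally show ?thesis
    unfolding has_vector_derivative_Pair_iff .
qed

end

theorem proposition7p2:
  fixes \<Omega> :: "real^'n^'n" and \<phi> :: "real^'n \<Rightarrow> real^'n" and w :: real
  assumes "even CARD('n)"
    and "two_form \<Omega>" and "nondegenerate \<Omega>"
    and "smooth \<phi>" and "\<forall>x. exterior_deriv \<phi> x = \<Omega>"
    and "w \<noteq> 0"
  shows "
    \<comment> \<open>the Dirac procedure applied to \<open>L\<close>: constraints, Hamiltonian and coordinates\<close>
    {(q, p). \<exists>v. p = legendre_momentum (lagrangian1 w \<phi> \<Omega>) q v} = constraint_surface \<Omega> \<and>
    constraint_surface \<Omega> = range (surface_point \<Omega>) \<and>
    (\<forall>q v. legendre_energy (lagrangian1 w \<phi> \<Omega>) q v =
        reduced_hamiltonian w \<phi> (reduced_coords (q, legendre_momentum (lagrangian1 w \<phi> \<Omega>) q v))) \<and>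
    second_class (constraint \<Omega>) \<and>
    bij (to_jet2 w \<phi> \<Omega>) \<and>
    (\<forall>x U P. to_jet2 w \<phi> \<Omega> (x, U, P) =
        (x, U, \<chi> a. \<Sum>b\<in>UNIV. (P $ b - w\<^sup>2 * \<phi> x $ b) * raised \<Omega> $ a $ b)) \<and>
    \<comment> \<open>the induced Poisson structure\<close>
    poisson_structure (induced_bracket w \<phi> \<Omega>) \<and>
    (\<forall>a b y. induced_bracket w \<phi> \<Omega> (x_coord a) (A_coord b) y = - raised \<Omega> $ a $ b) \<and>
    (\<forall>a b y. induced_bracket w \<phi> \<Omega> (U_coord a) (U_coord b) y = raised \<Omega> $ a $ b) \<and>
    (\<forall>a b y. induced_bracket w \<phi> \<Omega> (A_coord a) (A_coord b) y = w\<^sup>2 * raised \<Omega> $ a $ b) \<and>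
    (\<forall>a b y. induced_bracket w \<phi> \<Omega> (x_coord a) (x_coord b) y = 0) \<and>
    (\<forall>a b y. induced_bracket w \<phi> \<Omega> (x_coord a) (U_coord b) y = 0) \<and>
    (\<forall>a b y. induced_bracket w \<phi> \<Omega> (U_coord a) (A_coord b) y = 0) \<and>
    \<comment> \<open>Hamilton's equations\<close>
    (\<forall>z. jet2_hamiltonian \<Omega> (to_jet2 w \<phi> \<Omega> z) = reduced_hamiltonian w \<phi> z) \<and>
    (\<forall>I X U A. open I \<longrightarrow>
        (hamilton_equations (induced_bracket w \<phi> \<Omega>) (jet2_hamiltonian \<Omega>) I
           (\<lambda>t. (X t, U t, A t)) \<longleftrightarrow>
         (\<forall>t\<in>I. (X has_vector_derivative U t) (at t) \<and>
                (U has_vector_derivative A t) (at t) \<and>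
                (A has_vector_derivative - (w\<^sup>2) *\<^sub>R U t) (at t))))"
proof -
  interpret symplectic_potential \<Omega> \<phi> w
    using assms by unfold_locales auto
  have energy: "legendre_energy (lagrangian1 w \<phi> \<Omega>) q v =
      reduced_hamiltonian w \<phi> (reduced_coords (q, legendre_momentum (lagrangian1 w \<phi> \<Omega>) q v))" for q v
  proof -
    obtain x U l where q: "q = (x, U, l)" by (metis surj_pair)
    show ?thesis
      by (simp add: q legendre_energy_lagrangian1 legendre_momentum_lagrangian1 reduced_coords_def)
  qed
  have second_class: "second_class (constraint \<Omega>)"
    unfolding second_class_def using constraint_matrix_inverse(1)[OF two_form nondegenerate] ..
  have coords: "T (x, U, P) =
      (x, U, \<chi> a. \<Sum>b\<in>UNIV. (P $ b - w\<^sup>2 * \<phi> x $ b) * W $ a $ b)" for x U P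
    by (simp add: to_jet2_eq matrix_vector_mult_def mult.commute)
  show ?thesis
    unfolding legendre_image constraint_surface_eq_range
    by (intro conjI allI impI refl energy second_class bij_to_jet2 coords
        poisson_structure_induced_bracket induced_bracket_coords jet2_hamiltonian_to_jet2
        hamilton_equations_iff)
qed

end
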